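(* Let $d_{\mathfrak a}$ be a positive integer and let $d,t$ be indeterminates. For $0\le i\le d_{\mathfrak a}-1$ the eigenspace of $M_{d_{\mathfrak a}}(d,t)$ for the eigenvalue $\lambda_{d_{\mathfrak a}}(d,i)=(-1)^{d_{\mathfrak a}+1+i}\binom{d+d_{\mathfrak a}-1}{i}$ is spanned by the (column) vector $b=(b_0,\ldots,b_{d_{\mathfrak a}-1})$ defined by $$b_k=\binom{d_{\mathfrak a}-k-1}{d_{\mathfrak a}-i-1}+\sum_{j=0}^{d_{\mathfrak a}-i-2}\binom{d_{\mathfrak a}-k-1}{j}\left(\sum_{m=0}^{d_{\mathfrak a}-i-2-j}\ \sum_{0=i_0<i_1<\cdots<i_m<i_{m+1}=d_{\mathfrak a}-i-1-j}\ \prod_{k'=1}^{m+1}g_{i_{k'}}\binom{d_{\mathfrak a}+t}{i_{k'}-i_{k'-1}}\right)$$ for $0\le k\le d_{\mathfrak a}-1$. Here the coefficients $g_1,\ldots,g_{d_{\mathfrak a}-i-1}$ are given by $$g_k=\left((-1)^k\frac{\binom{d+d_{\mathfrak a}-1}{i+k}}{\binom{d+d_{\mathfrak a}-1}{i}}-1\right)^{-1}.$$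
   Context: For $k\in\mathbb{Z}$ and $x$ a number or polynomial, $\binom{x}{k}=\frac{x(x-1)\cdots(x-k+1)}{k!}$ if $k\ge 0$ and $\binom{x}{k}=0$ if $k<0$. For a positive integer $d_{\mathfrak a}$ and indeterminates $d,t$, $M_{d_{\mathfrak a}}(d,t)$ is the $d_{\mathfrak a}\times d_{\mathfrak a}$ matrix $$M_{d_{\mathfrak a}}(d,t):=\left(\binom{d_{\mathfrak a}+i+t-j-1}{d_{\mathfrak a}-j-1}\binom{d-i-t+j-1}{j}\right)_{0\le i,j\le d_{\mathfrak a}-1},$$ viewed as a matrix over the field of rational functions in $d,t$. The innermost sum runs over all strictly increasing integer sequences $i_0<i_1<\cdots<i_{m+1}$ with $i_0=0$ and $i_{m+1}=d_{\mathfrak a}-i-1-j$. Empty sums are $0$. *)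

theory Defs
  imports
    "Jordan_Normal_Form.Char_Poly"
    "Jordan_Normal_Form.VS_Connect"
    "HOL-Computational_Algebra.Polynomial_Factorial"
begin

text \<open>The generalised binomial coefficient divides by a factorial, so it is only
  available over fraction fields once these are known to have characteristic 0.\<close>

lemma to_fract_of_nat: "to_fract (of_nat n :: 'a::idom) = of_nat n"
  by (induction n) simp_all

instance fract :: ("{idom, ring_char_0}") field_char_0
proof
  show "inj (of_nat :: nat \<Rightarrow> 'a fract)"
    by (rule injI) (metis to_fract_of_nat to_fract_eq_iff of_nat_eq_iff)
qed

type_synonym 'a ratfun2 = "'a poly poly fract"

text \<open>The two indeterminates: \<open>d\<close> is the variable of the inner polynomial ring, \<open>t\<close> that
  of the outer one.\<close>

definition var_d :: "'a::field_char_0 ratfun2" where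
  "var_d = to_fract [:[:0, 1:]:]"

definition var_t :: "'a::field_char_0 ratfun2" where
  "var_t = to_fract [:0, 1:]"

definition M_mat :: "nat \<Rightarrow> 'b \<Rightarrow> 'b \<Rightarrow> 'b::field_char_0 mat" where
  "M_mat n d t = mat n n (\<lambda>(i, j).
     ((of_nat n + of_nat i + t - of_nat j - 1) gchoose (n - j - 1)) *
     ((d - of_nat i - t + of_nat j - 1) gchoose j))"

definition eigval :: "nat \<Rightarrow> 'b \<Rightarrow> nat \<Rightarrow> 'b::field_char_0" where
  "eigval n d i = (-1) ^ (n + 1 + i) * ((d + of_nat n - 1) gchoose i)"

definition g_coeff :: "nat \<Rightarrow> 'b \<Rightarrow> nat \<Rightarrow> nat \<Rightarrow> 'b::field_char_0" where
  "g_coeff n d i k =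
     inverse ((-1) ^ k * ((d + of_nat n - 1) gchoose (i + k)) / ((d + of_nat n - 1) gchoose i) - 1)"

text \<open>A sequence \<open>0 = i\<^sub>0 < i\<^sub>1 < \<dots> < i\<^sub>m < i\<^sub>m\<^sub>+\<^sub>1 = N\<close> is the list of its \<open>m + 2\<close> entries.\<close>

definition chains :: "nat \<Rightarrow> nat \<Rightarrow> nat list set" where
  "chains m N = {c. length c = m + 2 \<and> sorted_wrt (<) c \<and> c ! 0 = 0 \<and> c ! (m + 1) = N}"

text \<open>Half-open ranges replace \<open>0 \<le> j \<le> n - i - 2\<close> and \<open>0 \<le> m \<le> n - i - 2 - j\<close>, so that
  the sum over \<open>j\<close> is empty for \<open>i = n - 1\<close> despite truncated subtraction.\<close>

definition b_vec :: "nat \<Rightarrow> 'b \<Rightarrow> 'b \<Rightarrow> nat \<Rightarrow> 'b::field_char_0 vec" where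
  "b_vec n d t i = vec n (\<lambda>k.
     of_nat ((n - k - 1) choose (n - i - 1)) +
     (\<Sum>j = 0..<n - i - 1. of_nat ((n - k - 1) choose j) *
        (\<Sum>m = 0..<n - i - 1 - j. \<Sum>c \<in> chains m (n - i - 1 - j).
           \<Prod>k' = 1..m + 1. g_coeff n d i (c ! k') *
             ((of_nat n + t) gchoose (c ! k' - c ! (k' - 1))))))"

definition eigenspace :: "'b::field mat \<Rightarrow> 'b \<Rightarrow> 'b vec set" where
  "eigenspace A ev = {v \<in> carrier_vec (dim_row A). A *\<^sub>v v = ev \<cdot>\<^sub>v v}"

end

theory Submission
  imports Defs "HOL-Computational_Algebra.Formal_Power_Series"
begin

text \<open>
  Put \<open>e\<^sub>l = (binom (n - 1 - k) l)\<^sub>k\<close>; these vectors form a basis. By trinomial revision and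
  Vandermonde's convolution the matrix is triangular in it:
  \<open>M e\<^sub>l = \<mu>\<^sub>l (\<Sum>j\<le>l. binom (- n - t) (l - j) e\<^sub>j)\<close> with
  \<open>\<mu>\<^sub>l = (-1)^l binom (d + n - 1) (n - 1 - l)\<close>. The matrix of the numbers
  \<open>binom (- n - t) (l - j)\<close> is inverted by \<open>binom (n + t) (l - j)\<close>, so \<open>\<Sum>j. c\<^sub>j e\<^sub>j\<close> is an
  eigenvector for \<open>\<mu>\<^sub>L\<close>, \<open>L = n - 1 - i\<close>, iff
  \<open>\<mu>\<^sub>j c\<^sub>j = \<mu>\<^sub>L (\<Sum>l\<ge>j. binom (n + t) (l - j) c\<^sub>l)\<close> for all \<open>j\<close>. The \<open>\<mu>\<^sub>l\<close> are
  distinct because they have distinct degrees in \<open>d\<close>; hence the solution is unique up to the choice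
  of \<open>c\<^sub>L\<close>, and unrolling the recursion for \<open>c\<close> below \<open>L\<close> gives the sum over chains.
\<close>

section \<open>Binomial expansions\<close>

lemmas Vandermonde = gbinomial_Vandermonde[unfolded atLeast0AtMost]

text \<open>Newton interpolation at the nodes \<open>0, ..., n - 1\<close>: the matrix of the
  \<open>x choose j\<close> is unitriangular, so each new node fixes one new coefficient without any
  division.\<close>

lemma binomial_basis_exists:
  fixes f :: "nat \<Rightarrow> 'b::comm_ring_1"
  shows "\<exists>c. \<forall>x<n. f x = (\<Sum>j<n. of_nat (x choose j) * c j)"
proof (induction n)
  case (Suc n)
  then obtain c where c: "\<And>x. x < n \<Longrightarrow> f x = (\<Sum>j<n. of_nat (x choose j) * c j)" by blast
  define c' where "c' = c(n := f n - (\<Sum>j<n. of_nat (n choose j) * c j))"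
  have eq: "(\<Sum>j<n. of_nat (x choose j) * c' j) = (\<Sum>j<n. of_nat (x choose j) * c j)" for x
    by (rule sum.cong) (auto simp: c'_def)
  have "f x = (\<Sum>j<Suc n. of_nat (x choose j) * c' j)" if "x < Suc n" for x
    using that c by (cases "x = n") (auto simp: eq less_Suc_eq binomial_eq_0, simp add: c'_def)
  then show ?case by blast
qed auto

text \<open>Triangularity once more: at \<open>x = j\<close> the terms beyond \<open>j\<close>
  contain a zero binomial, and the terms before \<open>j\<close> vanish by induction.\<close>

lemma binomial_basis_unique:
  fixes c :: "nat \<Rightarrow> 'b::comm_ring_1"
  assumes "\<And>x. x < n \<Longrightarrow> (\<Sum>j<n. of_nat (x choose j) * c j) = 0"
  shows "j < n \<Longrightarrow> c j = 0"
proof (induction j rule: less_induct)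
  case (less j)
  have "of_nat (j choose k) * c k = 0" if "k < n" "k \<noteq> j" for k
    using that less.IH[of k] by (cases k j rule: linorder_cases) (auto simp: binomial_eq_0)
  then have "(\<Sum>k<n. of_nat (j choose k) * c k) = (\<Sum>k\<in>{j}. of_nat (j choose k) * c k)"
    using less.prems by (intro sum.mono_neutral_right) auto
  then show ?case using assms less.prems by simp
qed

lemma binomial_basis_cong:
  fixes c c' :: "nat \<Rightarrow> 'b::comm_ring_1"
  shows "(\<forall>x<n. (\<Sum>j<n. of_nat (x choose j) * c j) = (\<Sum>j<n. of_nat (x choose j) * c' j))
    \<longleftrightarrow> (\<forall>j<n. c j = c' j)"
proof
  assume "\<forall>x<n. (\<Sum>j<n. of_nat (x choose j) * c j) = (\<Sum>j<n. of_nat (x choose j) * c' j)"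
  then show "\<forall>j<n. c j = c' j"
    using binomial_basis_unique[of n "\<lambda>j. c j - c' j"]
    by (auto simp: right_diff_distrib sum_subtractf)
qed (auto intro: sum.cong)

text \<open>The two triangular Toeplitz matrices have generating functions \<open>(1 + X)^a\<close>
  and \<open>(1 + X)^(-a)\<close>, whose product is 1. In coefficients this is Vandermonde's
  convolution, with \<open>0 gchoose (p - j)\<close> as the Kronecker delta.\<close>

lemma gbinomial_toeplitz_inverse:
  fixes a :: "'b::field_char_0"
  assumes "\<And>j. j < n \<Longrightarrow> x j = (\<Sum>l=j..<n. ((- a) gchoose (l - j)) * y l)"
    and "j < n"
  shows "y j = (\<Sum>l=j..<n. (a gchoose (l - j)) * x l)"
proof -
  have "(\<Sum>l=j..<n. (a gchoose (l - j)) * x l)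
      = (\<Sum>l=j..<n. \<Sum>p=l..<n. (a gchoose (l - j)) * (((- a) gchoose (p - l)) * y p))"
    by (simp add: assms sum_distrib_left)
  also have "\<dots> = (\<Sum>p=j..<n. \<Sum>l=j..p. (a gchoose (l - j)) * (((- a) gchoose (p - l)) * y p))"
    unfolding sum.Sigma[OF finite_atLeastLessThan ballI[OF finite_atLeastLessThan]]
      sum.Sigma[OF finite_atLeastLessThan ballI[OF finite_atLeastAtMost]]
    by (rule sum.reindex_bij_witness[of _ "\<lambda>(p, l). (l, p)" "\<lambda>(l, p). (p, l)"]) auto
  also have "\<dots> = (\<Sum>p=j..<n. (0 gchoose (p - j)) * y p)"
  proof (rule sum.cong[OF refl])
    fix p assume p: "p \<in> {j..<n}"
    have "(\<Sum>l=j..p. (a gchoose (l - j)) * (((- a) gchoose (p - l)) * y p))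
        = (\<Sum>k\<le>p - j. (a gchoose k) * ((- a) gchoose (p - j - k))) * y p"
      unfolding sum_distrib_right using p
      by (intro sum.reindex_bij_witness[of _ "\<lambda>k. k + j" "\<lambda>l. l - j"]) auto
    then show "(\<Sum>l=j..p. (a gchoose (l - j)) * (((- a) gchoose (p - l)) * y p))
        = (0 gchoose (p - j)) * y p"
      by (simp only: Vandermonde add.right_inverse)
  qed
  also have "\<dots> = (\<Sum>p\<in>{j}. (0 gchoose (p - j)) * y p)"
    using assms(2) by (intro sum.mono_neutral_right) (auto simp: gbinomial_0_left)
  finally show ?thesis by simp
qed

section \<open>The matrix in the binomial basis\<close>

text \<open>The diagonal of the triangular form of the matrix, indexed by basis vectors. The
  eigenvalue with index \<open>i\<close> sits at \<open>l = n - 1 - i\<close>.\<close>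

definition diag_entry :: "nat \<Rightarrow> 'b::field_char_0 \<Rightarrow> nat \<Rightarrow> 'b" where
  "diag_entry n d l = (-1) ^ l * ((d + of_nat n - 1) gchoose (n - 1 - l))"

text \<open>After both upper arguments are negated, trinomial revision pulls
  \<open>a gchoose l\<close> out of the sum over \<open>j\<close>, and a Vandermonde convolution
  remains.\<close>

lemma M_row_binomial:
  fixes d t :: "'b::field_char_0"
  assumes "l < n"
  shows "(\<Sum>j<n. ((of_nat n + of_nat r + t - of_nat j - 1) gchoose (n - j - 1)) *
      ((d - of_nat r - t + of_nat j - 1) gchoose j) * of_nat ((n - 1 - j) choose l))
    = diag_entry n d l * ((- of_nat r - t - 1) gchoose l)"
proof -
  let ?f = "\<lambda>j. ((of_nat n + of_nat r + t - of_nat j - 1) gchoose (n - j - 1)) *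
      ((d - of_nat r - t + of_nat j - 1) gchoose j) * of_nat ((n - 1 - j) choose l)"
  define a where "a = - of_nat r - t - 1"
  have summand: "?f j = (-1) ^ (n - 1) * (a gchoose l) *
      ((of_nat r + t - d gchoose j) * (a - of_nat l gchoose (n - 1 - l - j)))"
    if j: "j \<le> n - 1 - l" for j
  proof -
    have lj: "l \<le> n - 1 - j" and jn: "j \<le> n - 1" using that assms by auto
    have 1: "(of_nat n + of_nat r + t - of_nat j - 1 gchoose (n - j - 1))
        = (-1) ^ (n - 1 - j) * (a gchoose (n - 1 - j))"
      using j assms by (subst gbinomial_negated_upper) (auto simp: a_def of_nat_diff algebra_simps)
    have 2: "(d - of_nat r - t + of_nat j - 1 gchoose j)
        = (-1) ^ j * (of_nat r + t - d gchoose j)"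
      by (subst gbinomial_negated_upper) (auto simp: algebra_simps)
    have 3: "(a gchoose (n - 1 - j)) * of_nat ((n - 1 - j) choose l)
        = (a gchoose l) * (a - of_nat l gchoose (n - 1 - j - l))"
      using gbinomial_trinomial_revision[OF lj, of a] by (simp add: binomial_gbinomial)
    have 4: "(-1 :: 'b) ^ (n - 1) = (-1) ^ (n - 1 - j) * (-1) ^ j"
      using jn by (metis le_add_diff_inverse2 power_add)
    have "?f j = ((-1) ^ (n - 1 - j) * (-1) ^ j) * (of_nat r + t - d gchoose j) *
        ((a gchoose (n - 1 - j)) * of_nat ((n - 1 - j) choose l))"
      by (simp only: 1 2 mult_ac)
    also have "\<dots> = (-1) ^ (n - 1) * (a gchoose l) *
      ((of_nat r + t - d gchoose j) * (a - of_nat l gchoose (n - 1 - j - l)))"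
      by (simp only: 3 4 mult_ac)
    also have "n - 1 - j - l = n - 1 - l - j" by simp
    finally show ?thesis .
  qed
  have "(\<Sum>j<n. ?f j) = (\<Sum>j\<le>n - 1 - l. ?f j)"
    using assms by (intro sum.mono_neutral_right) auto
  also have "\<dots> = (\<Sum>j\<le>n - 1 - l. (-1) ^ (n - 1) * (a gchoose l) *
      ((of_nat r + t - d gchoose j) * (a - of_nat l gchoose (n - 1 - l - j))))"
    by (rule sum.cong[OF refl], rule summand) simp
  also have "\<dots> = (-1) ^ (n - 1) * (a gchoose l) * ((of_nat r + t - d) + (a - of_nat l) gchoose (n - 1 - l))"
    by (simp only: Vandermonde sum_distrib_left[symmetric])
  \<comment> \<open>Here \<open>r + t\<close> cancels and the upper argument is
    \<open>- d - 1 - l\<close>. Hence the row \<open>r\<close> survives only in the factor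
    \<open>a gchoose l\<close>.\<close>
  also have "((of_nat r + t - d) + (a - of_nat l) gchoose (n - 1 - l))
      = (-1) ^ (n - 1 - l) * (d + of_nat n - 1 gchoose (n - 1 - l))"
    using assms by (subst gbinomial_negated_upper) (auto simp: a_def of_nat_diff algebra_simps)
  also have "(-1) ^ (n - 1) * (a gchoose l) * ((-1) ^ (n - 1 - l) * (d + of_nat n - 1 gchoose (n - 1 - l)))
      = ((-1) ^ (n - 1) * (-1) ^ (n - 1 - l)) * (d + of_nat n - 1 gchoose (n - 1 - l)) * (a gchoose l)"
    by (simp only: mult_ac)
  also have "(-1 :: 'b) ^ (n - 1) * (-1) ^ (n - 1 - l) = (-1) ^ l"
  proof -
    have "n - 1 + (n - 1 - l) = l + 2 * (n - 1 - l)" using assms by simp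
    then show ?thesis by (metis power_add power_minus1_even mult.right_neutral)
  qed
  finally show ?thesis by (simp add: diag_entry_def a_def)
qed

text \<open>Writing \<open>- r - t - 1\<close> as \<open>(n - 1 - r) + (- (n + t))\<close>,
  Vandermonde's convolution expands each image in the same binomial basis. The inner sums are thus
  the coordinates of the image of \<open>v\<close>.\<close>

lemma M_row_binomial_expansion:
  fixes d t :: "'b::field_char_0"
  assumes r: "r < n" and v: "\<And>k. k < n \<Longrightarrow> v k = (\<Sum>l<n. of_nat ((n - 1 - k) choose l) * c l)"
  shows "(\<Sum>j<n. ((of_nat n + of_nat r + t - of_nat j - 1) gchoose (n - j - 1)) *
      ((d - of_nat r - t + of_nat j - 1) gchoose j) * v j)
    = (\<Sum>j<n. of_nat ((n - 1 - r) choose j) *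
        (\<Sum>l=j..<n. ((- (of_nat n + t)) gchoose (l - j)) * (diag_entry n d l * c l)))"
    (is "(\<Sum>j<n. ?m j * v j) = _")
proof -
  have vand: "((- of_nat r - t - 1) gchoose l)
      = (\<Sum>j\<le>l. of_nat ((n - 1 - r) choose j) * ((- (of_nat n + t)) gchoose (l - j)))" for l
  proof -
    have "(- of_nat r - t - 1 :: 'b) = of_nat (n - 1 - r) + - (of_nat n + t)"
      using r by (simp add: of_nat_diff algebra_simps)
    then show ?thesis
      by (simp only: Vandermonde[symmetric] binomial_gbinomial)
  qed
  have "(\<Sum>j<n. ?m j * v j) = (\<Sum>j<n. \<Sum>l<n. ?m j * of_nat ((n - 1 - j) choose l) * c l)"
    by (intro sum.cong refl) (simp only: lessThan_iff v sum_distrib_left mult.assoc)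
  also have "\<dots> = (\<Sum>l<n. (\<Sum>j<n. ?m j * of_nat ((n - 1 - j) choose l)) * c l)"
    by (subst sum.swap) (simp add: sum_distrib_right)
  also have "\<dots> = (\<Sum>l<n. diag_entry n d l * ((- of_nat r - t - 1) gchoose l) * c l)"
    by (intro sum.cong refl) (simp only: lessThan_iff M_row_binomial)
  also have "\<dots> = (\<Sum>l<n. \<Sum>j\<le>l. of_nat ((n - 1 - r) choose j) *
        (((- (of_nat n + t)) gchoose (l - j)) * (diag_entry n d l * c l)))"
    by (simp add: vand sum_distrib_left sum_distrib_right mult_ac)
  also have "\<dots> = (\<Sum>j<n. \<Sum>l=j..<n. of_nat ((n - 1 - r) choose j) *
        (((- (of_nat n + t)) gchoose (l - j)) * (diag_entry n d l * c l)))"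
    unfolding sum.Sigma[OF finite_lessThan ballI[OF finite_atMost]]
      sum.Sigma[OF finite_lessThan ballI[OF finite_atLeastLessThan]]
    by (rule sum.reindex_bij_witness[of _ "\<lambda>(p, l). (l, p)" "\<lambda>(l, p). (p, l)"]) auto
  finally show ?thesis by (simp add: sum_distrib_left)
qed

lemma M_eigen_iff_recursion:
  fixes d t ev :: "'b::field_char_0"
  assumes v: "v \<in> carrier_vec n"
    and vc: "\<And>k. k < n \<Longrightarrow> v $ k = (\<Sum>l<n. of_nat ((n - 1 - k) choose l) * c l)"
  shows "M_mat n d t *\<^sub>v v = ev \<cdot>\<^sub>v v \<longleftrightarrow>
    (\<forall>j<n. diag_entry n d j * c j = ev * (\<Sum>l=j..<n. ((of_nat n + t) gchoose (l - j)) * c l))"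
proof -
  let ?y = "\<lambda>l. diag_entry n d l * c l"
  let ?T = "\<lambda>j. \<Sum>l=j..<n. ((- (of_nat n + t)) gchoose (l - j)) * ?y l"
  have Mv: "(M_mat n d t *\<^sub>v v) $ r = (\<Sum>j<n. of_nat ((n - 1 - r) choose j) * ?T j)" if "r < n" for r
    using that v M_row_binomial_expansion[OF that vc, where d = d and t = t]
    by (simp add: M_mat_def scalar_prod_def lessThan_atLeast0)
  have evv: "(ev \<cdot>\<^sub>v v) $ r = (\<Sum>j<n. of_nat ((n - 1 - r) choose j) * (ev * c j))" if "r < n" for r
    using that v by (simp add: vc sum_distrib_left mult_ac)
  have "M_mat n d t *\<^sub>v v = ev \<cdot>\<^sub>v v \<longleftrightarrow> (\<forall>r<n. (M_mat n d t *\<^sub>v v) $ r = (ev \<cdot>\<^sub>v v) $ r)"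
    using v by (auto simp: vec_eq_iff M_mat_def)
  also have "\<dots> \<longleftrightarrow> (\<forall>r<n. (\<Sum>j<n. of_nat ((n - 1 - r) choose j) * ?T j)
      = (\<Sum>j<n. of_nat ((n - 1 - r) choose j) * (ev * c j)))"
    by (simp only: Mv evv cong: imp_cong)
  \<comment> \<open>The reversal \<open>x = n - 1 - r\<close> permutes the indices below
    \<open>n\<close>.\<close>
  also have "\<dots> \<longleftrightarrow> (\<forall>x<n. (\<Sum>j<n. of_nat (x choose j) * ?T j)
      = (\<Sum>j<n. of_nat (x choose j) * (ev * c j)))" (is "(\<forall>r<n. ?P (n - 1 - r)) \<longleftrightarrow> _")
  proof
    assume L: "\<forall>r<n. ?P (n - 1 - r)"
    show "\<forall>x<n. ?P x"
    proof (intro allI impI)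
      fix x assume "x < n"
      then show "?P x" using L[rule_format, of "n - 1 - x"] by simp
    qed
  qed simp
  also have "\<dots> \<longleftrightarrow> (\<forall>j<n. ?T j = ev * c j)" by (rule binomial_basis_cong)
  \<comment> \<open>Inverting the Toeplitz matrix moves it to the side of the eigenvalue, where its
    upper argument is \<open>n + t\<close>, as in \<open>b_vec\<close>.\<close>
  also have "\<dots> \<longleftrightarrow> (\<forall>j<n. ?y j = (\<Sum>l=j..<n. ((of_nat n + t) gchoose (l - j)) * (ev * c l)))"
  proof
    assume T: "\<forall>j<n. ?T j = ev * c j"
    show "\<forall>j<n. ?y j = (\<Sum>l=j..<n. ((of_nat n + t) gchoose (l - j)) * (ev * c l))"
      by (intro allI impI, rule gbinomial_toeplitz_inverse[OF T[rule_format, symmetric]])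
  next
    assume y: "\<forall>j<n. ?y j = (\<Sum>l=j..<n. ((of_nat n + t) gchoose (l - j)) * (ev * c l))"
    show "\<forall>j<n. ?T j = ev * c j"
      by (intro allI impI, rule gbinomial_toeplitz_inverse[symmetric])
        (simp_all only: y minus_minus)
  qed
  finally show ?thesis by (simp add: sum_distrib_left mult_ac)
qed

section \<open>Sums over chains\<close>

text \<open>With \<open>g\<close> and \<open>w\<close> arbitrary, the combinatorics of chains is
  kept apart from the binomials that replace \<open>w\<close> later.\<close>

definition chain_weight :: "(nat \<Rightarrow> 'b) \<Rightarrow> (nat \<Rightarrow> 'b) \<Rightarrow> nat \<Rightarrow> nat \<Rightarrow> 'b::comm_ring_1" where
  "chain_weight g w m N = (\<Sum>c \<in> chains m N. \<Prod>k = 1..m + 1. g (c ! k) * w (c ! k - c ! (k - 1)))"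

definition chain_sum :: "(nat \<Rightarrow> 'b) \<Rightarrow> (nat \<Rightarrow> 'b) \<Rightarrow> nat \<Rightarrow> 'b::comm_ring_1" where
  "chain_sum g w N = (\<Sum>m = 0..<N. chain_weight g w m N)"

lemma chains_0: "0 < N \<Longrightarrow> chains 0 N = {[0, N]}"
  by (auto simp: chains_def length_Suc_conv numeral_2_eq_2)

lemma chains_nth_ge:
  assumes "c \<in> chains m N" "k \<le> m + 1"
  shows "k \<le> c ! k"
  using assms(2)
proof (induction k)
  case (Suc k)
  have "c ! k < c ! Suc k"
    using assms(1) Suc.prems by (auto simp: chains_def sorted_wrt_iff_nth_less)
  then show ?case using Suc by simp
qed simp

lemma chains_empty: "N \<le> m \<Longrightarrow> chains m N = {}"
  using chains_nth_ge[of _ m N "m + 1"] by (fastforce simp: chains_def)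

lemma finite_chains: "finite (chains m N)"
proof (rule finite_subset)
  show "chains m N \<subseteq> {xs. set xs \<subseteq> {..N} \<and> length xs = m + 2}"
  proof
    fix c assume c: "c \<in> chains m N"
    have "c ! k \<le> N" if "k < m + 2" for k
      using that c by (cases "k = m + 1") (auto simp: chains_def sorted_wrt_iff_nth_less less_imp_le)
    then show "c \<in> {xs. set xs \<subseteq> {..N} \<and> length xs = m + 2}"
      using c by (auto simp: chains_def in_set_conv_nth)
  qed
qed (simp add: finite_lists_length_eq)

text \<open>Chains are sorted by their penultimate entry \<open>k\<close>. It is positive because at
  least one step precedes it.\<close>

lemma chains_Suc: "chains (Suc m) N = (\<Union>k\<in>{1..<N}. (\<lambda>c. c @ [N]) ` chains m k)"
proof (intro equalityI subsetI)
  fix c assume c: "c \<in> chains (Suc m) N"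
  define b where "b = butlast c"
  have len: "length c = m + 3" and srt: "sorted_wrt (<) c" and z: "c ! 0 = 0" and N: "c ! (m + 2) = N"
    using c by (auto simp: chains_def)
  have "c \<noteq> []" using len by auto
  then have cb: "c = b @ [N]"
    using len N append_butlast_last_id[of c] by (simp add: b_def last_conv_nth)
  have lb: "length b = m + 2" using len by (simp add: b_def)
  have "b \<in> chains m (b ! (m + 1))"
    using srt z lb by (auto simp: chains_def cb sorted_wrt_append nth_append)
  moreover have "b ! (m + 1) < N"
    using srt lb by (simp add: cb sorted_wrt_append)
  moreover have "1 \<le> b ! (m + 1)"
    using chains_nth_ge[OF \<open>b \<in> chains m (b ! (m + 1))\<close>, of "m + 1"] by simp
  ultimately show "c \<in> (\<Union>k\<in>{1..<N}. (\<lambda>c. c @ [N]) ` chains m k)"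
    using cb by auto
next
  fix c assume "c \<in> (\<Union>k\<in>{1..<N}. (\<lambda>c. c @ [N]) ` chains m k)"
  then obtain k b where k: "1 \<le> k" "k < N" and b: "b \<in> chains m k" and c: "c = b @ [N]" by auto
  have "x < N" if x: "x \<in> set b" for x
  proof -
    from x b obtain p where p: "p < m + 2" "x = b ! p" by (auto simp: in_set_conv_nth chains_def)
    have "b ! p \<le> k"
      using b p by (cases "p = m + 1") (auto simp: chains_def sorted_wrt_iff_nth_less less_imp_le)
    then show ?thesis using k p by simp
  qed
  then show "c \<in> chains (Suc m) N"
    using b k by (auto simp: chains_def c sorted_wrt_append nth_append)
qed

lemma chain_weight_0: "0 < N \<Longrightarrow> chain_weight g w 0 N = g N * w N"
  by (simp add: chain_weight_def chains_0)

lemma chain_weight_Suc: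
  "chain_weight g w (Suc m) N = (\<Sum>k = 1..<N. chain_weight g w m k * (g N * w (N - k)))"
proof -
  let ?F = "\<lambda>m c. \<Prod>k = 1..m + 1. g (c ! k) * w (c ! k - c ! (k - 1))"
  have disj: "\<forall>k\<in>{1..<N}. \<forall>k'\<in>{1..<N}. k \<noteq> k' \<longrightarrow>
      (\<lambda>c. c @ [N]) ` chains m k \<inter> (\<lambda>c. c @ [N]) ` chains m k' = {}"
    by (auto simp: chains_def)
  have inj: "inj_on (\<lambda>c. c @ [N]) (chains m k)" for k by (auto simp: inj_on_def)
  have F: "?F (Suc m) (c @ [N]) = ?F m c * (g N * w (N - k))" if "c \<in> chains m k" for c k
  proof -
    have len: "length c = m + 2" and last: "c ! (m + 1) = k" using that by (auto simp: chains_def)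
    have "?F (Suc m) (c @ [N]) = (\<Prod>j = 1..m + 1. g ((c @ [N]) ! j) * w ((c @ [N]) ! j - (c @ [N]) ! (j - 1)))
        * (g N * w (N - k))"
      using len last by (simp add: nth_append)
    also have "(\<Prod>j = 1..m + 1. g ((c @ [N]) ! j) * w ((c @ [N]) ! j - (c @ [N]) ! (j - 1))) = ?F m c"
      using len by (intro prod.cong) (auto simp: nth_append)
    finally show ?thesis .
  qed
  have "chain_weight g w (Suc m) N = (\<Sum>k = 1..<N. \<Sum>c\<in>(\<lambda>c. c @ [N]) ` chains m k. ?F (Suc m) c)"
    unfolding chain_weight_def chains_Suc
    by (rule sum.UNION_disjoint) (use disj finite_chains in auto)
  also have "\<dots> = (\<Sum>k = 1..<N. \<Sum>c\<in>chains m k. ?F m c * (g N * w (N - k)))"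
    by (rule sum.cong[OF refl]) (subst sum.reindex[OF inj], rule sum.cong[OF refl], simp only: o_def F)
  finally show ?thesis by (simp add: chain_weight_def sum_distrib_right)
qed

text \<open>Longer chains do not fit below \<open>N\<close>. A range of \<open>m\<close> common to
  all \<open>N\<close> allows the sums over \<open>m\<close> and over the penultimate entry to be
  interchanged.\<close>

lemma chain_sum_extend:
  assumes "N \<le> K"
  shows "chain_sum g w N = (\<Sum>m = 0..<K. chain_weight g w m N)"
  unfolding chain_sum_def using assms
  by (intro sum.mono_neutral_left) (auto simp: chain_weight_def chains_empty)

text \<open>The last step of a chain starts either at 0, which gives \<open>w N\<close>, or at some
  \<open>k\<close> with \<open>0 < k < N\<close>, where a shorter chain ends. In both cases it
  contributes the factor \<open>g N\<close>.\<close>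

lemma chain_sum_rec:
  assumes "0 < N"
  shows "chain_sum g w N = g N * (w N + (\<Sum>k = 1..<N. w (N - k) * chain_sum g w k))"
proof -
  obtain K where K: "N = Suc K" using assms gr0_implies_Suc by blast
  have "chain_sum g w N = chain_weight g w 0 N + (\<Sum>m = 0..<K. chain_weight g w (Suc m) N)"
    by (simp only: chain_sum_def K sum.atLeast0_lessThan_Suc_shift o_def)
  also have "(\<Sum>m = 0..<K. chain_weight g w (Suc m) N)
      = (\<Sum>k = 1..<N. (\<Sum>m = 0..<K. chain_weight g w m k) * (g N * w (N - k)))"
    unfolding chain_weight_Suc by (subst sum.swap) (simp add: sum_distrib_right)
  also have "\<dots> = (\<Sum>k = 1..<N. chain_sum g w k * (g N * w (N - k)))"
    by (intro sum.cong refl) (simp add: chain_sum_extend[of _ K] K)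
  finally show ?thesis
    using assms by (simp add: chain_weight_0 distrib_left sum_distrib_left mult_ac)
qed

section \<open>The eigenspaces\<close>

text \<open>The indeterminates enter the eigenspace computation only through the two conditions on
  \<open>diag_entry\<close>, so \<open>d\<close> and \<open>t\<close> are kept as field elements
  here.\<close>

context
  fixes n i :: nat and d t :: "'b::field_char_0"
  assumes i: "i < n"
    and distinct: "\<And>j. j < n \<Longrightarrow> j \<noteq> n - 1 - i \<Longrightarrow> diag_entry n d j \<noteq> diag_entry n d (n - 1 - i)"
    and nonzero: "diag_entry n d (n - 1 - i) \<noteq> 0"
begin

private abbreviation "L \<equiv> n - 1 - i"

private abbreviation "w \<equiv> \<lambda>m. (of_nat n + t) gchoose m"

lemma eigval_eq_diag_entry: "eigval n d i = diag_entry n d L"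
proof -
  \<comment> \<open>The exponents of -1 on both sides have the same parity.\<close>
  have "n + 1 + i = L + 2 * (i + 1)" and "n - 1 - L = i" using i by auto
  then show ?thesis
    unfolding eigval_def diag_entry_def by (simp only: power_add power_minus1_even mult_1_right)
qed

text \<open>Lowering the basis index from \<open>L\<close> to \<open>L - k\<close> raises the lower
  index of the binomial from \<open>i\<close> to \<open>i + k\<close> and changes the sign by
  \<open>(-1)^k\<close>. So the ratio in \<open>g_coeff\<close> is a quotient of two diagonal
  entries.\<close>

lemma g_coeff_eq:
  assumes "k \<le> L"
  shows "g_coeff n d i k = inverse (diag_entry n d (L - k) / diag_entry n d L - 1)"
proof -
  have "n - 1 - (L - k) = i + k" "n - 1 - L = i" using i assms by auto
  moreover have "(-1 :: 'b) ^ (L - k) = (-1) ^ L * (-1) ^ k"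
  proof -
    have "(-1 :: 'b) ^ L = (-1) ^ (L - k) * (-1) ^ k"
      using power_add[of "-1 :: 'b" "L - k" k] by (simp only: le_add_diff_inverse2[OF assms])
    then show ?thesis by (simp add: mult.assoc)
  qed
  ultimately show ?thesis
    by (simp add: g_coeff_def diag_entry_def mult.assoc)
qed

text \<open>One equation of the triangular system: \<open>x\<close> is the unknown coordinate at
  \<open>L - k\<close>, and \<open>y\<close> collects the coordinates already known. Distinctness of
  the diagonal entries makes it solvable for \<open>x\<close>.\<close>

lemma g_coeff_solves:
  assumes "0 < k" "k \<le> L"
  shows "diag_entry n d (L - k) * x = diag_entry n d L * (x + y) \<longleftrightarrow> x = g_coeff n d i k * y"
proof -
  define A B where "A = diag_entry n d (L - k)" and "B = diag_entry n d L"
  have AB: "A - B \<noteq> 0"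
    using distinct[of "L - k"] assms i by (auto simp: A_def B_def)
  have "A / B - 1 = (A - B) / B"
    using nonzero by (simp add: B_def diff_divide_distrib)
  then have g: "g_coeff n d i k * y = B * y / (A - B)"
    by (simp only: g_coeff_eq[OF assms(2)] A_def[symmetric] B_def[symmetric] inverse_divide
        times_divide_eq_left)
  have "A * x = B * (x + y) \<longleftrightarrow> x * (A - B) = B * y"
    by (auto simp: algebra_simps)
  then show ?thesis
    unfolding g nonzero_eq_divide_eq[OF AB] by (simp only: A_def B_def)
qed

text \<open>Coordinates of \<open>b_vec\<close> in the binomial basis, normalised at
  \<open>L\<close>. The value 1 there is set separately, since \<open>chain_sum\<close> at 0 is an
  empty sum.\<close>

definition eigen_coord :: "nat \<Rightarrow> 'b" where
  "eigen_coord j = (if j = L then 1 else if j < L then chain_sum (g_coeff n d i) w (L - j) else 0)"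

lemma b_vec_eq:
  assumes "k < n"
  shows "b_vec n d t i $ k = (\<Sum>l<n. of_nat ((n - 1 - k) choose l) * eigen_coord l)"
proof -
  have "(\<Sum>l<n. of_nat ((n - 1 - k) choose l) * eigen_coord l)
      = (\<Sum>l<Suc L. of_nat ((n - 1 - k) choose l) * eigen_coord l)"
    using i by (intro sum.mono_neutral_right) (auto simp: eigen_coord_def)
  also have "\<dots> = of_nat ((n - 1 - k) choose L) +
      (\<Sum>l<L. of_nat ((n - 1 - k) choose l) * chain_sum (g_coeff n d i) w (L - l))"
    by (simp add: eigen_coord_def add.commute)
  finally show ?thesis
    using assms by (simp add: b_vec_def chain_sum_def chain_weight_def lessThan_atLeast0 diff_right_commute)
qed

text \<open>The \<open>j\<close>-th equation of the triangular system forces \<open>c j = 0\<close> above \<open>L\<close>, is void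
  at \<open>j = L\<close>, and determines \<open>c j\<close> from the later coordinates below \<open>L\<close>.\<close>

lemma recursion_iff:
  "(\<forall>j<n. diag_entry n d j * c j = diag_entry n d L * (\<Sum>l=j..<n. w (l - j) * c l))
    \<longleftrightarrow> (\<forall>j<n. c j = c L * eigen_coord j)" (is "?rec c \<longleftrightarrow> _")
proof -
  let ?eq = "\<lambda>c j. diag_entry n d j * c j = diag_entry n d L * (\<Sum>l=j..<n. w (l - j) * c l)"
  \<comment> \<open>The term at \<open>l = j\<close> has coefficient \<open>w 0 = 1\<close>.\<close>
  have split: "(\<Sum>l=j..<n. w (l - j) * c l) = c j + (\<Sum>l=Suc j..<n. w (l - j) * c l)"
    if "j < n" for j and c :: "nat \<Rightarrow> 'b"
    using that by (simp add: sum.atLeast_Suc_lessThan)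
  \<comment> \<open>Descending induction: once the later coordinates vanish, equation
    \<open>j\<close> says that two distinct diagonal entries agree after multiplication by
    \<open>c j\<close>.\<close>
  have above: "c j = 0" if "?rec c" "L < j" "j < n" for c j
    using that(2,3)
  proof (induction "n - j" arbitrary: j rule: less_induct)
    case less
    have "(\<Sum>l=Suc j..<n. w (l - j) * c l) = 0"
      using less by (intro sum.neutral) auto
    then have "diag_entry n d j * c j = diag_entry n d L * c j"
      using that(1) less.prems split[of j c] by simp
    then show ?case using distinct[of j] less.prems by auto
  qed
  \<comment> \<open>The sum is reindexed by the distance \<open>k = L - l\<close>, which matches the
    index of \<open>g_coeff\<close> and of the chain sums.\<close>
  have trunc: "(\<Sum>l=Suc j..<n. w (l - j) * c l) = (\<Sum>k=0..<L - j. w (L - j - k) * c (L - k))"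
    if "\<And>l. L < l \<Longrightarrow> l < n \<Longrightarrow> c l = 0" "j \<le> L" for j and c :: "nat \<Rightarrow> 'b"
  proof -
    have "(\<Sum>l=Suc j..<n. w (l - j) * c l) = (\<Sum>l=Suc j..L. w (l - j) * c l)"
      using that i by (intro sum.mono_neutral_right) auto
    also have "\<dots> = (\<Sum>k=0..<L - j. w (L - j - k) * c (L - k))"
      using that(2)
      by (intro sum.reindex_bij_witness[of _ "\<lambda>k. L - k" "\<lambda>l. L - l"]) (auto simp: diff_right_commute)
    finally show ?thesis .
  qed
  have below: "?eq c (L - k) \<longleftrightarrow> c (L - k) = g_coeff n d i k * (\<Sum>m=0..<k. w (k - m) * c (L - m))"
    if "\<And>l. L < l \<Longrightarrow> l < n \<Longrightarrow> c l = 0" "0 < k" "k \<le> L" for k and c :: "nat \<Rightarrow> 'b"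
  proof -
    have "L - k < n" "L - k \<le> L" "L - (L - k) = k" using that i by auto
    then show ?thesis
      using split[of "L - k" c] trunc[OF that(1), where j = "L - k"] g_coeff_solves[OF that(2,3)] by simp
  qed
  \<comment> \<open>The term at \<open>m = 0\<close> is \<open>w k\<close>, since the coordinate at
    \<open>L\<close> is 1. It is the contribution of the chain with a single step.\<close>
  have rec_coord: "eigen_coord (L - k)
      = g_coeff n d i k * (\<Sum>m=0..<k. w (k - m) * eigen_coord (L - m))"
    if k: "0 < k" "k \<le> L" for k
  proof -
    have "(\<Sum>m=1..<k. w (k - m) * eigen_coord (L - m))
        = (\<Sum>m=1..<k. w (k - m) * chain_sum (g_coeff n d i) w m)"
      using k by (intro sum.cong) (auto simp: eigen_coord_def)
    then show ?thesis
      using k chain_sum_rec[of k "g_coeff n d i" w]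
      by (simp add: eigen_coord_def sum.atLeast_Suc_lessThan[of 0 k])
  qed
  show ?thesis
  proof
    assume rec: "?rec c"
    have c0: "c l = 0" if "L < l" "l < n" for l using above[OF rec that] .
    have "c (L - k) = c L * eigen_coord (L - k)" if "k \<le> L" for k
      using that
    proof (induction k rule: less_induct)
      case (less k)
      show ?case
      proof (cases "k = 0")
        case False
        have k: "0 < k" "k \<le> L" using False less.prems by auto
        have "L - k < n" using i by simp
        then have "?eq c (L - k)" using rec by blast
        then have "c (L - k) = g_coeff n d i k * (\<Sum>m=0..<k. w (k - m) * c (L - m))"
          by (rule iffD1[OF below, rotated -1]) (use c0 k in auto)
        also have "(\<Sum>m=0..<k. w (k - m) * c (L - m))
            = (\<Sum>m=0..<k. c L * (w (k - m) * eigen_coord (L - m)))"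
        proof (rule sum.cong[OF refl])
          fix m assume "m \<in> {0..<k}"
          then have "c (L - m) = c L * eigen_coord (L - m)" using less by simp
          then show "w (k - m) * c (L - m) = c L * (w (k - m) * eigen_coord (L - m))"
            by (simp only: mult_ac)
        qed
        finally show ?thesis
          by (simp only: rec_coord[OF k] sum_distrib_left[symmetric] mult.left_commute)
      qed (simp add: eigen_coord_def)
    qed
    then have "c j = c L * eigen_coord j" if "j \<le> L" for j
      using that diff_diff_cancel[OF that] diff_le_self[of L j] by metis
    moreover have "c j = c L * eigen_coord j" if "L < j" "j < n" for j
      using c0[OF that] that by (simp add: eigen_coord_def)
    ultimately show "\<forall>j<n. c j = c L * eigen_coord j"
      by (meson not_le)
  next
    assume c: "\<forall>j<n. c j = c L * eigen_coord j"
    have e0: "eigen_coord l = 0" if "L < l" "l < n" for l using that by (simp add: eigen_coord_def)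
    have e: "?eq eigen_coord j" if "j < n" for j
    proof (cases "j \<ge> L")
      case True
      have "(\<Sum>l=Suc j..<n. w (l - j) * eigen_coord l) = 0"
        using True by (intro sum.neutral) (auto simp: eigen_coord_def)
      then have "(\<Sum>l=j..<n. w (l - j) * eigen_coord l) = eigen_coord j"
        using split[OF that, of eigen_coord] by simp
      then show ?thesis using True by (cases "j = L") (simp_all add: eigen_coord_def)
    next
      case False
      then have k: "0 < L - j" "L - j \<le> L" and Lj: "L - (L - j) = j" by auto
      have "?eq eigen_coord (L - (L - j))"
        by (rule iffD2[OF below]) (use e0 k rec_coord[OF k] in auto)
      then show ?thesis unfolding Lj .
    qed
    have "?eq c j" if "j < n" for j
    proof -
      have "(\<Sum>l=j..<n. w (l - j) * c l) = (\<Sum>l=j..<n. c L * (w (l - j) * eigen_coord l))"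
      proof (rule sum.cong[OF refl])
        fix l assume "l \<in> {j..<n}"
        then have "l < n" by simp
        then have "c l = c L * eigen_coord l" using c by blast
        then show "w (l - j) * c l = c L * (w (l - j) * eigen_coord l)"
          by (simp only: mult_ac)
      qed
      also have "\<dots> = c L * (\<Sum>l=j..<n. w (l - j) * eigen_coord l)"
        by (simp only: sum_distrib_left)
      finally have s: "(\<Sum>l=j..<n. w (l - j) * c l) = c L * (\<Sum>l=j..<n. w (l - j) * eigen_coord l)" .
      have cj: "c j = c L * eigen_coord j" using c that by blast
      have "diag_entry n d j * c j = c L * (diag_entry n d j * eigen_coord j)"
        by (subst cj) (simp only: mult.left_commute)
      also have "\<dots> = diag_entry n d L * (\<Sum>l=j..<n. w (l - j) * c l)"
        unfolding s e[OF that] by (simp only: mult_ac)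
      finally show ?thesis .
    qed
    then show "?rec c" by blast
  qed
qed

lemma M_eigen_iff:
  assumes v: "v \<in> carrier_vec n"
  shows "M_mat n d t *\<^sub>v v = eigval n d i \<cdot>\<^sub>v v \<longleftrightarrow> (\<exists>a. v = a \<cdot>\<^sub>v b_vec n d t i)"
proof -
  \<comment> \<open>Interpolating the reversed entries of \<open>v\<close> gives its coordinates in
    the binomial basis.\<close>
  obtain c where c0: "\<And>x. x < n \<Longrightarrow> v $ (n - 1 - x) = (\<Sum>l<n. of_nat (x choose l) * c l)"
    using binomial_basis_exists[of n "\<lambda>x. v $ (n - 1 - x)"] by blast
  have c: "v $ k = (\<Sum>l<n. of_nat ((n - 1 - k) choose l) * c l)" if "k < n" for k
    using c0[of "n - 1 - k"] that by simp
  have smult: "(a \<cdot>\<^sub>v b_vec n d t i) $ k = (\<Sum>l<n. of_nat ((n - 1 - k) choose l) * (a * eigen_coord l))"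
    if "k < n" for a k
  proof -
    have "(a \<cdot>\<^sub>v b_vec n d t i) $ k = a * (b_vec n d t i $ k)"
      using that by (simp add: b_vec_def)
    then show ?thesis
      by (simp only: b_vec_eq[OF that] sum_distrib_left mult.left_commute)
  qed
  have vec: "v = a \<cdot>\<^sub>v b_vec n d t i \<longleftrightarrow> (\<forall>j<n. c j = a * eigen_coord j)" for a
  proof -
    have "v = a \<cdot>\<^sub>v b_vec n d t i \<longleftrightarrow> (\<forall>k<n. v $ k = (a \<cdot>\<^sub>v b_vec n d t i) $ k)"
      using v by (auto simp: vec_eq_iff b_vec_def)
    also have "\<dots> \<longleftrightarrow> (\<forall>x<n. v $ (n - 1 - x) = (a \<cdot>\<^sub>v b_vec n d t i) $ (n - 1 - x))"
    proof
      assume R: "\<forall>x<n. v $ (n - 1 - x) = (a \<cdot>\<^sub>v b_vec n d t i) $ (n - 1 - x)"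
      show "\<forall>k<n. v $ k = (a \<cdot>\<^sub>v b_vec n d t i) $ k"
      proof (intro allI impI)
        fix k assume "k < n"
        then have "n - 1 - (n - 1 - k) = k" "n - 1 - k < n" by auto
        then show "v $ k = (a \<cdot>\<^sub>v b_vec n d t i) $ k" using R by metis
      qed
    qed simp
    also have "\<dots> \<longleftrightarrow> (\<forall>x<n. (\<Sum>l<n. of_nat (x choose l) * c l)
        = (\<Sum>l<n. of_nat (x choose l) * (a * eigen_coord l)))"
      using c0 smult by (intro all_cong) simp
    also have "\<dots> \<longleftrightarrow> (\<forall>j<n. c j = a * eigen_coord j)" by (rule binomial_basis_cong)
    finally show ?thesis .
  qed
  have "M_mat n d t *\<^sub>v v = eigval n d i \<cdot>\<^sub>v v \<longleftrightarrow> (\<forall>j<n. c j = c L * eigen_coord j)"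
    unfolding eigval_eq_diag_entry recursion_iff[symmetric] by (rule M_eigen_iff_recursion[OF v c])
  also have "\<dots> \<longleftrightarrow> (\<exists>a. \<forall>j<n. c j = a * eigen_coord j)"
  proof
    assume "\<exists>a. \<forall>j<n. c j = a * eigen_coord j"
    then obtain a where a: "\<forall>j<n. c j = a * eigen_coord j" by blast
    moreover have "L < n" using i by simp
    \<comment> \<open>The scalar is read off at \<open>L\<close>, where the coordinate of
      \<open>b_vec\<close> is 1.\<close>
    ultimately have "c L = a" by (simp add: eigen_coord_def)
    with a show "\<forall>j<n. c j = c L * eigen_coord j" by simp
  qed blast
  finally show ?thesis using vec by simp
qed

lemma b_vec_nonzero: "b_vec n d t i \<noteq> 0\<^sub>v n"
proof
  assume z: "b_vec n d t i = 0\<^sub>v n"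
  have "(\<Sum>l<n. of_nat (x choose l) * eigen_coord l) = 0" if "x < n" for x
    using b_vec_eq[of "n - 1 - x"] that by (simp add: z)
  then have "eigen_coord L = 0" by (rule binomial_basis_unique) (use i in auto)
  then show False by (simp add: eigen_coord_def)
qed

end

lemma span_singleton_vec:
  fixes v :: "'b::field vec"
  assumes "v \<in> carrier_vec n"
  shows "LinearCombinations.module.span class_ring (module_vec TYPE('b) n) {v} = {a \<cdot>\<^sub>v v | a. True}"
proof -
  interpret vec_space "TYPE('b)" n .
  have "span {v} = {lincomb a {v} | a. True}"
    using assms by (subst finite_span) auto
  also have "\<dots> = {a v \<cdot>\<^sub>v v | a. True}"
    using assms by (auto simp: lincomb_def)
  also have "\<dots> = {a \<cdot>\<^sub>v v | a. True}" by auto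
  finally show ?thesis .
qed

section \<open>Distinctness of the eigenvalues\<close>

text \<open>Multiplication by the factorial clears the denominator and leaves a falling factorial in
  the inner variable \<open>d\<close>, so that degrees of polynomials become available.\<close>

lemma gchoose_linear_poly:
  fixes a :: "'a::field_char_0"
  shows "fact k * (to_fract [:[:a, 1:]:] gchoose k) = to_fract [:\<Prod>j = 0..<k. [:a - of_nat j, 1:]:]"
proof (induction k)
  case (Suc k)
  have "fact (Suc k) * (to_fract [:[:a, 1:]:] gchoose Suc k)
      = (fact k * (to_fract [:[:a, 1:]:] gchoose k)) * (to_fract [:[:a, 1:]:] - of_nat k)"
    by (simp only: gbinomial_mult_fact prod.atLeast0_lessThan_Suc)
  also have "to_fract [:[:a, 1:]:] - of_nat k = to_fract [:[:a - of_nat k, 1:]:]"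
    by (simp add: to_fract_of_nat[symmetric] to_fract_diff[symmetric] of_nat_poly del: to_fract_diff)
  finally show ?case
    by (simp add: Suc.IH to_fract_mult[symmetric] mult.commute del: to_fract_mult)
qed (simp add: pCons_one)

lemma degree_falling_prod:
  "degree (\<Prod>j = 0..<k. [:a - of_nat j, 1 :: 'a::field_char_0:]) = k"
  by (subst degree_prod_sum_eq) auto

lemma gchoose_linear_nonzero:
  fixes a :: "'a::field_char_0"
  shows "to_fract [:[:a, 1:]:] gchoose k \<noteq> 0"
proof
  assume "to_fract [:[:a, 1:]:] gchoose k = 0"
  then have "(\<Prod>j = 0..<k. [:a - of_nat j, 1:]) = 0"
    using gchoose_linear_poly[of k a] by simp
  then show False by simp
qed

text \<open>After cross-multiplication by the factorials, both sides are squares of polynomials in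
  \<open>d\<close>, of degrees \<open>2 * k\<close> and \<open>2 * m\<close>. The squares serve to
  absorb the signs in \<open>diag_entry\<close>.\<close>

lemma gchoose_linear_square_inj:
  fixes a :: "'a::field_char_0"
  assumes "(to_fract [:[:a, 1:]:] gchoose k)\<^sup>2 = (to_fract [:[:a, 1:]:] gchoose m)\<^sup>2"
  shows "k = m"
proof -
  let ?P = "\<lambda>k. \<Prod>j = 0..<k. [:a - of_nat j, 1:]"
  let ?X = "to_fract [:[:a, 1:]:]"
  \<comment> \<open>Factorials are nonzero constants of the inner polynomial ring and leave degrees
    unchanged.\<close>
  have f: "(fact k :: 'a ratfun2) = to_fract [:[:fact k:]:]" for k
    using to_fract_of_nat[of "fact k", where 'a = "'a poly poly"] by (simp add: of_nat_poly)
  have "(fact m * (fact k * (?X gchoose k)))\<^sup>2 = (fact k * (fact m * (?X gchoose m)))\<^sup>2"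
    using assms by (simp add: power_mult_distrib mult_ac)
  then have "to_fract (([:[:fact m:]:] * [:?P k:])^2) = to_fract (([:[:fact k:]:] * [:?P m:])^2)"
    by (simp only: gchoose_linear_poly) (simp only: f to_fract_mult power2_eq_square)
  then have "[:[:fact m:] * ?P k:]^2 = [:[:fact k:] * ?P m:]^2"
    by simp
  then have "([:fact m:] * ?P k)^2 = ([:fact k:] * ?P m)^2"
    by (simp add: power2_eq_square)
  then have "degree (([:fact m:] * ?P k)^2) = degree (([:fact k:] * ?P m)^2)" by simp
  then show ?thesis
    by (simp add: degree_power_eq degree_falling_prod)
qed

lemma var_d_shift: "(var_d :: 'a::field_char_0 ratfun2) + of_nat n - 1 = to_fract [:[:of_nat n - 1, 1:]:]"
  by (simp add: var_d_def to_fract_of_nat[symmetric] to_fract_1[symmetric] to_fract_diff[symmetric]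
      to_fract_add[symmetric] of_nat_poly one_pCons del: to_fract_diff to_fract_1 to_fract_add)

lemma diag_entry_var_d_nonzero: "diag_entry n (var_d :: 'a::field_char_0 ratfun2) j \<noteq> 0"
  by (simp add: diag_entry_def var_d_shift gchoose_linear_nonzero)

lemma diag_entry_var_d_inj:
  assumes "diag_entry n (var_d :: 'a::field_char_0 ratfun2) j = diag_entry n var_d l" "j < n" "l < n"
  shows "j = l"
proof -
  have "(diag_entry n (var_d :: 'a ratfun2) j)\<^sup>2 = (diag_entry n var_d l)\<^sup>2"
    using assms by simp
  then have "n - 1 - j = n - 1 - l"
    unfolding diag_entry_def var_d_shift power_mult_distrib
    by (intro gchoose_linear_square_inj) (simp flip: power_mult)
  then show ?thesis using assms(2,3) by simp
qed

theorem theorem3: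
  fixes n i :: nat
  assumes "0 < n" and "i \<le> n - 1"
  shows "eigenvalue (M_mat n var_d var_t) (eigval n var_d i :: 'a::field_char_0 ratfun2) \<and>
    eigenspace (M_mat n var_d var_t) (eigval n var_d i :: 'a ratfun2) =
      LinearCombinations.module.span class_ring (module_vec TYPE('a ratfun2) n)
        {b_vec n var_d var_t i}"
proof
  let ?M = "M_mat n var_d var_t :: 'a ratfun2 mat"
  let ?b = "b_vec n var_d var_t i :: 'a ratfun2 vec"
  have i: "i < n" using assms by simp
  have distinct: "diag_entry n (var_d :: 'a ratfun2) j \<noteq> diag_entry n var_d (n - 1 - i)"
    if "j < n" "j \<noteq> n - 1 - i" for j
    using diag_entry_var_d_inj that i by fastforce
  note ctx = i distinct diag_entry_var_d_nonzero
  have dim: "dim_row ?M = n" by (simp add: M_mat_def)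
  have b: "?b \<in> carrier_vec n" by (simp add: b_vec_def)
  have eigen_iff: "?M *\<^sub>v v = eigval n var_d i \<cdot>\<^sub>v v \<longleftrightarrow> (\<exists>a. v = a \<cdot>\<^sub>v ?b)"
    if "v \<in> carrier_vec n" for v
    using M_eigen_iff[OF ctx that] .
  \<comment> \<open>The witness is the scalar 1.\<close>
  have "?M *\<^sub>v ?b = eigval n var_d i \<cdot>\<^sub>v ?b"
    using eigen_iff[OF b] one_smult_vec by metis
  then show "eigenvalue ?M (eigval n var_d i)"
    using b b_vec_nonzero[OF ctx] by (auto simp: eigenvalue_def eigenvector_def dim)
  show "eigenspace ?M (eigval n var_d i)
      = LinearCombinations.module.span class_ring (module_vec TYPE('a ratfun2) n) {?b}"
    unfolding span_singleton_vec[OF b] eigenspace_def dim using eigen_iff b by auto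
qed

end
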